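(* Let $V$ be a finite set and let $\{(K_t,\pi_t)\}_{t\ge1}$ be a finite non-decreasing environment on $V$. For each $t\ge1$ let $\tilde\pi_t=\pi_t/\pi_t(V)$. Then for all $x,y\in V$ the sequence $$\left(\frac{1}{\pi_t(V)}\,s_\infty(\mu_t^x,\mu_t^y\mid\tilde\pi_t)\right)_{t\ge1}$$ is non-increasing.
   Context: A Markov transition operator $K$ on $V$ is a map $K:V\times V\to[0,1]$ with $\sum_y K(x,y)=1$ for all $x$; it acts on measures by $(\mu K)(y)=\sum_x\mu(x)K(x,y)$. Finite non-decreasing environment: $(K_t)_{t\ge1}$ are Markov transition operators and $(\pi_t)_{t\ge1}$ positive measures ($\pi_t(x)>0$ for all $x$) with, for all $t\ge1$: $\pi_tK_t=\pi_t$; $\pi_t(V)<+\infty$; $\pi_{t+1}(x)\ge\pi_t(x)$ for all $x\in V$. $\mu_t^x=\delta_xK_1K_2\cdots K_t$ is the law at time $t$ of the chain started at $x$ and driven by $(K_t)_{t\ge1}$. For a probability $\tilde\pi$ with $\tilde\pi(z)>0$ for all $z$, $s_\infty(\mu,\nu\mid\tilde\pi)=\max_{z\in V}\left|\frac{\mu(z)-\nu(z)}{\tilde\pi(z)}\right|$. *)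

theory Defs
  imports "HOL-Analysis.Analysis"
begin

text \<open>
  The state space is a set \<open>V\<close>; measures on it are represented by their point masses and
  transition operators by their kernels, whose values outside \<open>V\<close> are irrelevant.
  Sequences are indexed by \<open>nat\<close>, and the values \<open>K 0\<close> and \<open>\<pi> 0\<close> are never constrained or used.
\<close>

definition markov_operator :: "'a set \<Rightarrow> ('a \<Rightarrow> 'a \<Rightarrow> real) \<Rightarrow> bool" where
  "markov_operator V K \<longleftrightarrow>
     (\<forall>x\<in>V. \<forall>y\<in>V. 0 \<le> K x y \<and> K x y \<le> 1) \<and> (\<forall>x\<in>V. (K x has_sum 1) V)"

definition act :: "'a set \<Rightarrow> ('a \<Rightarrow> real) \<Rightarrow> ('a \<Rightarrow> 'a \<Rightarrow> real) \<Rightarrow> 'a \<Rightarrow> real" where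
  "act V \<mu> K y = (\<Sum>\<^sub>\<infinity>x\<in>V. \<mu> x * K x y)"

definition mass :: "'a set \<Rightarrow> ('a \<Rightarrow> real) \<Rightarrow> real" where
  "mass V \<mu> = (\<Sum>\<^sub>\<infinity>x\<in>V. \<mu> x)"

text \<open>For positive point masses, \<open>\<pi> t summable_on V\<close> says that \<open>\<pi> t\<close> has finite total mass.\<close>

definition finite_nondecreasing_environment ::
  "'a set \<Rightarrow> (nat \<Rightarrow> 'a \<Rightarrow> 'a \<Rightarrow> real) \<Rightarrow> (nat \<Rightarrow> 'a \<Rightarrow> real) \<Rightarrow> bool" where
  "finite_nondecreasing_environment V K \<pi> \<longleftrightarrow>
     (\<forall>t\<ge>1. markov_operator V (K t)
        \<and> (\<forall>x\<in>V. \<pi> t x > 0)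
        \<and> (\<forall>x\<in>V. act V (\<pi> t) (K t) x = \<pi> t x)
        \<and> \<pi> t summable_on V
        \<and> (\<forall>x\<in>V. \<pi> (Suc t) x \<ge> \<pi> t x))"

definition normalize_measure :: "'a set \<Rightarrow> ('a \<Rightarrow> real) \<Rightarrow> 'a \<Rightarrow> real" where
  "normalize_measure V \<mu> x = \<mu> x / mass V \<mu>"

definition dirac :: "'a \<Rightarrow> 'a \<Rightarrow> real" where
  "dirac x y = (if y = x then 1 else 0)"

primrec law :: "'a set \<Rightarrow> (nat \<Rightarrow> 'a \<Rightarrow> 'a \<Rightarrow> real) \<Rightarrow> 'a \<Rightarrow> nat \<Rightarrow> 'a \<Rightarrow> real" where
  "law V K x 0 = dirac x"
| "law V K x (Suc t) = act V (law V K x t) (K (Suc t))"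

definition s_infty :: "'a set \<Rightarrow> ('a \<Rightarrow> real) \<Rightarrow> ('a \<Rightarrow> real) \<Rightarrow> ('a \<Rightarrow> real) \<Rightarrow> real" where
  "s_infty V \<mu> \<nu> p = (MAX z\<in>V. \<bar>(\<mu> z - \<nu> z) / p z\<bar>)"

end

theory Submission
  imports Defs
begin

text \<open>
  Dividing by the total mass turns the normalised distance into \<open>max \<bar>\<mu> - \<nu>\<bar> / \<pi>\<^sub>t\<close>. If
  \<open>\<bar>\<mu> - \<nu>\<bar> \<le> c \<pi>\<^sub>t\<close> pointwise, then also \<open>\<bar>\<mu> - \<nu>\<bar> \<le> c \<pi>\<^sub>t\<^sub>+\<^sub>1\<close> because the environment grows, and
  the positive operator \<open>K\<^sub>t\<^sub>+\<^sub>1\<close>, which fixes \<open>\<pi>\<^sub>t\<^sub>+\<^sub>1\<close>, preserves this bound.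
\<close>

lemma act_finite: "finite V \<Longrightarrow> act V \<mu> K y = (\<Sum>x\<in>V. \<mu> x * K x y)"
  by (simp add: act_def)

lemma mass_pos:
  assumes "finite V" "V \<noteq> {}" "\<And>x. x \<in> V \<Longrightarrow> p x > 0"
  shows "mass V p > 0"
  using assms by (simp add: mass_def sum_pos)

text \<open>Nonnegative kernel entries let the absolute value pass inside the sum, and invariance of
  \<open>p\<close> at \<open>y\<close> turns the dominating sum back into
  \<open>c * p y\<close>.\<close>

lemma abs_act_diff_le:
  assumes "finite V" "y \<in> V"
    and "markov_operator V K"
    and "act V p K y = p y"
    and bound: "\<And>x. x \<in> V \<Longrightarrow> \<bar>\<mu> x - \<nu> x\<bar> \<le> c * p x"
  shows "\<bar>act V \<mu> K y - act V \<nu> K y\<bar> \<le> c * p y"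
proof -
  have K: "0 \<le> K x y" if "x \<in> V" for x
    using assms that by (simp add: markov_operator_def)
  have "\<bar>act V \<mu> K y - act V \<nu> K y\<bar> = \<bar>\<Sum>x\<in>V. (\<mu> x - \<nu> x) * K x y\<bar>"
    using \<open>finite V\<close> by (simp add: act_finite sum_subtractf left_diff_distrib)
  also have "\<dots> \<le> (\<Sum>x\<in>V. \<bar>\<mu> x - \<nu> x\<bar> * K x y)"
    using K by (intro order_trans[OF sum_abs]) (simp add: abs_mult)
  also have "\<dots> \<le> (\<Sum>x\<in>V. c * p x * K x y)"
    using bound K by (intro sum_mono mult_right_mono)
  also have "\<dots> = c * act V p K y"
    using \<open>finite V\<close> by (simp add: act_finite sum_distrib_left mult.assoc)
  finally show ?thesis
    using assms by simp
qed

text \<open>Describing the maximum through its upper bounds \<open>c\<close> lets later arguments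
  work pointwise, without \<open>MAX\<close> or division.\<close>

lemma s_infty_le_iff:
  assumes "finite V" "V \<noteq> {}" "\<And>z. z \<in> V \<Longrightarrow> p z > 0"
  shows "s_infty V \<mu> \<nu> p \<le> c \<longleftrightarrow> (\<forall>z\<in>V. \<bar>\<mu> z - \<nu> z\<bar> \<le> c * p z)"
proof -
  have "\<bar>(\<mu> z - \<nu> z) / p z\<bar> \<le> c \<longleftrightarrow> \<bar>\<mu> z - \<nu> z\<bar> \<le> c * p z" if "z \<in> V" for z
    using assms(3)[OF that] by (simp add: pos_divide_le_eq)
  then show ?thesis
    using assms(1,2) by (simp add: s_infty_def)
qed

text \<open>Dividing by \<open>p / m\<close> instead of \<open>p\<close> scales every ratio by the
  mass \<open>m\<close>, which the prefactor cancels.\<close>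

lemma s_infty_normalize_measure:
  assumes "finite V" "V \<noteq> {}" "\<And>x. x \<in> V \<Longrightarrow> p x > 0"
  shows "1 / mass V p * s_infty V \<mu> \<nu> (normalize_measure V p) = s_infty V \<mu> \<nu> p"
proof -
  let ?m = "mass V p"
  have m: "?m > 0"
    using assms by (rule mass_pos)
  have np: "normalize_measure V p z > 0" if "z \<in> V" for z
    using assms m that by (simp add: normalize_measure_def)
  \<comment> \<open>Two reals with the same upper bounds are equal, so no scalar has to be moved
    through \<open>MAX\<close>.\<close>
  have "1 / ?m * s_infty V \<mu> \<nu> (normalize_measure V p) \<le> c \<longleftrightarrow> s_infty V \<mu> \<nu> p \<le> c" for c
  proof -
    have "1 / ?m * s_infty V \<mu> \<nu> (normalize_measure V p) \<le> c
        \<longleftrightarrow> s_infty V \<mu> \<nu> (normalize_measure V p) \<le> c * ?m"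
      using m by (simp add: pos_divide_le_eq)
    also have "\<dots> \<longleftrightarrow> s_infty V \<mu> \<nu> p \<le> c"
      using assms m np by (simp add: s_infty_le_iff) (simp add: normalize_measure_def)
    finally show ?thesis .
  qed
  then show ?thesis
    by (metis order_antisym order_refl)
qed

theorem lemma1p15:
  fixes V :: "'a set"
    and K :: "nat \<Rightarrow> 'a \<Rightarrow> 'a \<Rightarrow> real"
    and \<pi> :: "nat \<Rightarrow> 'a \<Rightarrow> real"
  assumes "finite V"
    and "finite_nondecreasing_environment V K \<pi>"
  shows "\<forall>x\<in>V. \<forall>y\<in>V. antimono_on {1..}
    (\<lambda>t. 1 / mass V (\<pi> t) *
          s_infty V (law V K x t) (law V K y t) (normalize_measure V (\<pi> t)))"
proof (intro ballI)
  fix x y assume "x \<in> V" "y \<in> V"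
  then have V: "finite V" "V \<noteq> {}"
    using assms by auto
  have env: "markov_operator V (K t)" "\<And>z. z \<in> V \<Longrightarrow> \<pi> t z > 0"
      "\<And>z. z \<in> V \<Longrightarrow> act V (\<pi> t) (K t) z = \<pi> t z"
      "\<And>z. z \<in> V \<Longrightarrow> \<pi> t z \<le> \<pi> (Suc t) z" if "t \<ge> 1" for t
    using assms(2) that by (auto simp: finite_nondecreasing_environment_def)
  define S where "S t = s_infty V (law V K x t) (law V K y t) (\<pi> t)" for t
  have step: "S (Suc t) \<le> S t" if t: "t \<ge> 1" for t
  proof -
    have le: "\<bar>law V K x t z - law V K y t z\<bar> \<le> S t * \<pi> t z" if "z \<in> V" for z
      using s_infty_le_iff[of V "\<pi> t" "law V K x t" "law V K y t" "S t"] V env(2)[OF t] that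
      by (simp add: S_def)
    \<comment> \<open>The sign is what allows \<open>\<pi> t\<close> to be replaced by the larger
      \<open>\<pi> (Suc t)\<close>; it is read off at the point \<open>x\<close>, where
      \<open>\<pi> t\<close> is positive.\<close>
    have "0 \<le> S t"
      using le[OF \<open>x \<in> V\<close>] env(2)[OF t \<open>x \<in> V\<close>]
      by (meson abs_ge_zero order_trans zero_le_mult_iff not_less)
    then have "\<bar>law V K x t z - law V K y t z\<bar> \<le> S t * \<pi> (Suc t) z" if "z \<in> V" for z
      using le[OF that] env(4)[OF t that] by (meson mult_left_mono order_trans)
    \<comment> \<open>The kernel leading from time \<open>t\<close> to \<open>Suc t\<close> is
      \<open>K (Suc t)\<close>, which fixes \<open>\<pi> (Suc t)\<close>; hence the measure is
      enlarged before the kernel acts.\<close>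
    then have "\<bar>law V K x (Suc t) z - law V K y (Suc t) z\<bar> \<le> S t * \<pi> (Suc t) z"
      if "z \<in> V" for z
      using that V env[of "Suc t"] by (simp add: abs_act_diff_le)
    then show ?thesis
      unfolding S_def[of "Suc t"] using V env(2)[of "Suc t"] by (subst s_infty_le_iff) auto
  qed
  \<comment> \<open>The induction starts at \<open>s\<close>, so every index it meets is at least 1,
    as \<open>step\<close> requires.\<close>
  have "S t \<le> S s" if "1 \<le> s" "s \<le> t" for s t
    using that(2,1) by (induction rule: dec_induct) (auto intro: order_trans[OF step])
  then show "antimono_on {1..}
    (\<lambda>t. 1 / mass V (\<pi> t) *
          s_infty V (law V K x t) (law V K y t) (normalize_measure V (\<pi> t)))"
    \<comment> \<open>The deleted rule would merge the prefactor into one fraction and hide the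
      left-hand side of \<open>s_infty_normalize_measure\<close>.\<close>
    using V env(2) by (auto simp: monotone_on_def S_def s_infty_normalize_measure simp del: times_divide_eq_left)
qed

end
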